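(* The Lie point symmetries of the system $$\ddot q_1-q_1\dot q_3=0,\qquad \ddot q_2-q_2\dot q_3=0,\qquad \ddot q_3+q_1\dot q_1+q_2\dot q_2=0$$ form a $4$-dimensional (real) Lie algebra under the Lie bracket of vector fields.
   Context: A smooth vector field $$\mathbf{u}=\xi(q_1,q_2,q_3,t)\frac{\partial}{\partial t}+\sum_{i=1}^3\eta_i(q_1,q_2,q_3,t)\frac{\partial}{\partial q_i}$$ on $\mathbb{R}^4$ with coordinates $(t,q_1,q_2,q_3)$ is a Lie point symmetry of the system if the action of its second prolongation $$pr^{(2)}(\mathbf{u})=\mathbf{u}+\sum_{i}(\dot\eta_i-\dot\xi\dot q_i)\frac{\partial}{\partial\dot q_i}+\sum_i\left(\ddot\eta_i-\ddot\xi\dot q_i-2\dot\xi\ddot q_i\right)\frac{\partial}{\partial\ddot q_i}$$ on the equations vanishes, identically in the independent variables $t,q_1,q_2,q_3,\dot q_1,\dot q_2,\dot q_3$ after $\ddot q_1,\ddot q_2,\ddot q_3$ have been replaced using the system by $q_1\dot q_3$, $q_2\dot q_3$, $-q_1\dot q_1-q_2\dot q_2$ respectively. Dots on $\xi,\eta_i$ denote total time derivatives, e.g. $\dot\xi=\frac{\partial\xi}{\partial t}+\sum_j\dot q_j\frac{\partial\xi}{\partial q_j}$. *)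

theory Defs
  imports "HOL-Analysis.Analysis" "HOL-Library.Function_Algebras"
begin

text \<open>On finite-dimensional spaces \<open>Ck k\<close> is the usual class \<open>C\<^sup>k\<close>: all iterated
  directional derivatives up to order \<open>k\<close> exist and are continuous.\<close>

primrec Ck :: "nat \<Rightarrow> ('a::real_normed_vector \<Rightarrow> 'b::real_normed_vector) \<Rightarrow> bool" where
  "Ck 0 f \<longleftrightarrow> continuous_on UNIV f"
| "Ck (Suc k) f \<longleftrightarrow> (\<forall>x. f differentiable (at x)) \<and>
     (\<forall>v. Ck k (\<lambda>x. frechet_derivative f (at x) v))"

definition smooth :: "('a::real_normed_vector \<Rightarrow> 'b::real_normed_vector) \<Rightarrow> bool" where
  "smooth f \<longleftrightarrow> (\<forall>k. Ck k f)"

text \<open>A vector field on a Euclidean space is given by its vector of coefficients. Applied as a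
  first-order differential operator to \<open>f\<close> it yields the directional derivative
  \<open>\<Sum>\<^sub>i X\<^sub>i \<partial>f/\<partial>x\<^sub>i\<close>; for vector-valued \<open>f\<close> this is taken componentwise.\<close>

definition vf_apply ::
  "('a::real_normed_vector \<Rightarrow> 'a) \<Rightarrow> ('a \<Rightarrow> 'b::real_normed_vector) \<Rightarrow> 'a \<Rightarrow> 'b" where
  "vf_apply X f x = frechet_derivative f (at x) (X x)"

text \<open>The coefficients of \<open>[X, Y]\<close> are \<open>X(Y\<^sub>i) - Y(X\<^sub>i)\<close>.\<close>

definition vf_bracket :: "('a::real_normed_vector \<Rightarrow> 'a) \<Rightarrow> ('a \<Rightarrow> 'a) \<Rightarrow> 'a \<Rightarrow> 'a" where
  "vf_bracket X Y = (\<lambda>x. vf_apply X Y x - vf_apply Y X x)"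

definition vf_scale :: "real \<Rightarrow> ('a \<Rightarrow> 'b::real_vector) \<Rightarrow> 'a \<Rightarrow> 'b" where
  "vf_scale c X = (\<lambda>x. c *\<^sub>R X x)"

global_interpretation vf: vector_space vf_scale
  by unfold_locales (auto simp: vf_scale_def fun_eq_iff algebra_simps)

text \<open>\<open>L\<close> is a linear subspace of an ambient real vector space; the bracket is only required to
  behave on \<open>L\<close>.\<close>

locale real_lie_algebra = vector_space scale
  for scale :: "real \<Rightarrow> 'a::ab_group_add \<Rightarrow> 'a" +
  fixes bracket :: "'a \<Rightarrow> 'a \<Rightarrow> 'a" and L :: "'a set"
  assumes subspace: "subspace L"
    and closed: "\<lbrakk>x \<in> L; y \<in> L\<rbrakk> \<Longrightarrow> bracket x y \<in> L"
    and add_left: "\<lbrakk>x \<in> L; y \<in> L; z \<in> L\<rbrakk> \<Longrightarrow> bracket (x + y) z = bracket x z + bracket y z"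
    and add_right: "\<lbrakk>x \<in> L; y \<in> L; z \<in> L\<rbrakk> \<Longrightarrow> bracket x (y + z) = bracket x y + bracket x z"
    and scale_left: "\<lbrakk>x \<in> L; y \<in> L\<rbrakk> \<Longrightarrow> bracket (scale c x) y = scale c (bracket x y)"
    and scale_right: "\<lbrakk>x \<in> L; y \<in> L\<rbrakk> \<Longrightarrow> bracket x (scale c y) = scale c (bracket x y)"
    and alternating: "x \<in> L \<Longrightarrow> bracket x x = 0"
    and jacobi: "\<lbrakk>x \<in> L; y \<in> L; z \<in> L\<rbrakk> \<Longrightarrow>
      bracket x (bracket y z) + bracket y (bracket z x) + bracket z (bracket x y) = 0"

text \<open>\<open>(t, q)\<close>, \<open>(t, q, v)\<close> and \<open>(t, q, v, a)\<close> with \<open>v\<close>, \<open>a\<close> standing for the first and second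
  time derivatives of \<open>q\<close>, all regarded as independent coordinates.\<close>

type_synonym point = "real \<times> (real^3)"
type_synonym jet1 = "real \<times> (real^3) \<times> (real^3)"
type_synonym jet2 = "real \<times> (real^3) \<times> (real^3) \<times> (real^3)"

text \<open>\<open>partial f b x\<close> is the partial derivative of \<open>f\<close> at \<open>x\<close> along the coordinate axis spanned by
  the unit vector \<open>b\<close>.\<close>

definition partial :: "('a::real_normed_vector \<Rightarrow> real) \<Rightarrow> 'a \<Rightarrow> 'a \<Rightarrow> real" where
  "partial f b x = frechet_derivative f (at x) b"

definition total_deriv :: "(point \<Rightarrow> real) \<Rightarrow> jet1 \<Rightarrow> real" where
  "total_deriv f = (\<lambda>(t, q, v).
     partial f (1, 0) (t, q) + (\<Sum>j\<in>UNIV. v $ j * partial f (0, axis j 1) (t, q)))"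

definition total_deriv1 :: "(jet1 \<Rightarrow> real) \<Rightarrow> jet2 \<Rightarrow> real" where
  "total_deriv1 F = (\<lambda>(t, q, v, a).
     partial F (1, 0, 0) (t, q, v)
     + (\<Sum>j\<in>UNIV. v $ j * partial F (0, axis j 1, 0) (t, q, v))
     + (\<Sum>j\<in>UNIV. a $ j * partial F (0, 0, axis j 1) (t, q, v)))"

definition total_deriv2 :: "(point \<Rightarrow> real) \<Rightarrow> jet2 \<Rightarrow> real" where
  "total_deriv2 f = total_deriv1 (total_deriv f)"

definition xi :: "(point \<Rightarrow> point) \<Rightarrow> point \<Rightarrow> real" where
  "xi u p = fst (u p)"

definition eta :: "(point \<Rightarrow> point) \<Rightarrow> 3 \<Rightarrow> point \<Rightarrow> real" where
  "eta u i p = snd (u p) $ i"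

definition prolong2 :: "(point \<Rightarrow> point) \<Rightarrow> jet2 \<Rightarrow> jet2" where
  "prolong2 u = (\<lambda>(t, q, v, a).
     (xi u (t, q),
      \<chi> i. eta u i (t, q),
      \<chi> i. total_deriv (eta u i) (t, q, v) - total_deriv (xi u) (t, q, v) * v $ i,
      \<chi> i. total_deriv2 (eta u i) (t, q, v, a) - total_deriv2 (xi u) (t, q, v, a) * v $ i
            - 2 * total_deriv (xi u) (t, q, v) * a $ i))"

definition eq1 :: "jet2 \<Rightarrow> real" where
  "eq1 = (\<lambda>(t, q, v, a). a $ 1 - q $ 1 * v $ 3)"

definition eq2 :: "jet2 \<Rightarrow> real" where
  "eq2 = (\<lambda>(t, q, v, a). a $ 2 - q $ 2 * v $ 3)"

definition eq3 :: "jet2 \<Rightarrow> real" where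
  "eq3 = (\<lambda>(t, q, v, a). a $ 3 + q $ 1 * v $ 1 + q $ 2 * v $ 2)"

definition acceleration :: "real^3 \<Rightarrow> real^3 \<Rightarrow> real^3" where
  "acceleration q v = vector [q $ 1 * v $ 3, q $ 2 * v $ 3, - q $ 1 * v $ 1 - q $ 2 * v $ 2]"

definition lie_point_symmetry :: "(point \<Rightarrow> point) \<Rightarrow> bool" where
  "lie_point_symmetry u \<longleftrightarrow> smooth u \<and>
     (\<forall>E\<in>{eq1, eq2, eq3}. \<forall>t q v.
        vf_apply (prolong2 u) E (t, q, v, acceleration q v) = 0)"

end

theory Submission
  imports Defs
begin

text \<open>
  Write \<open>\<xi>\<close>, \<open>\<eta>\<^sub>1\<close>, \<open>\<eta>\<^sub>2\<close>, \<open>\<eta>\<^sub>3\<close> for the coefficients of a symmetry \<open>u\<close> and \<open>a\<close> for the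
  acceleration prescribed by the system. The symmetry condition must hold for all velocities
  \<open>v\<close>, and since \<open>a\<close> is linear in \<open>v\<close>, the condition at a fixed point \<open>(t, q)\<close> is a polynomial of
  degree three in \<open>v\<close>. Replacing \<open>v\<close> by \<open>s v\<close> splits it into homogeneous parts, each of which
  vanishes on its own (\<open>symmetry_graded\<close>). The parts are linear partial differential equations
  for \<open>\<xi>\<close> and \<open>\<eta>\<close>, and comparing coefficients and differentiating once more reduces them to constants:

  \<^item> The cubic part says that \<open>\<xi>\<close> is affine in \<open>q\<close>.
  \<^item> The quadratic part gives each \<open>\<partial>\<^sub>j\<partial>\<^sub>k\<eta>\<^sub>i\<close> as a combination of the \<open>\<partial>\<^sub>t\<partial>\<^sub>l\<xi>\<close>, with constant
    coefficients, and of the \<open>\<partial>\<^sub>l\<xi>\<close>, with coefficients linear in \<open>q\<close>. Such a prescribed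
    Hessian is integrable only if mixed third derivatives agree, which forces \<open>\<partial>\<^sub>j\<xi> = 0\<close> (\<open>xi_space_gradient\<close>). Hence \<open>\<xi>\<close> depends on \<open>t\<close>
    alone and all \<open>\<eta>\<^sub>i\<close> are affine in \<open>q\<close>.
  \<^item> The linear part then determines the first derivatives of \<open>\<eta>\<close> in \<open>q\<close>: \<open>-\<xi>\<^sub>t\<close> on the diagonal, a skew
    pair in the \<open>(q\<^sub>1, q\<^sub>2)\<close> plane and zeros elsewhere (\<open>eta_first_order\<close>). The last component of the
    linear part yields \<open>\<xi>\<^sub>t\<^sub>t = 0\<close>.
  \<^item> The part of degree zero shows that \<open>\<eta>\<^sub>3\<close> does not depend on \<open>t\<close>.

  What remains are four real constants, and \<open>u\<close> is a combination of the time translation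
  \<open>\<partial>\<^sub>t\<close>, the scaling \<open>t \<partial>\<^sub>t - \<Sum>\<^sub>i q\<^sub>i \<partial>\<^sub>i\<close>, the rotation \<open>q\<^sub>2 \<partial>\<^sub>1 - q\<^sub>1 \<partial>\<^sub>2\<close> and the translation \<open>\<partial>\<^sub>3\<close>
  (\<open>symmetry_imp_field\<close>). Conversely these four affine fields satisfy the symmetry condition, they
  are linearly independent, and their brackets are combinations of them, so that the Lie algebra
  laws become identities between the four constants.

  The analytic input is the equality of mixed partial derivatives (\<open>partial_commute\<close>), because
  the integrability argument compares third derivatives taken in different orders.
\<close>

section \<open>Smooth functions\<close>

lemma smooth_differentiable: "smooth f \<Longrightarrow> f differentiable (at x)"
  unfolding smooth_def by (metis Ck.simps(2))

lemma smooth_continuous: "smooth f \<Longrightarrow> continuous_on UNIV f"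
  unfolding smooth_def by (metis Ck.simps(1))

lemma smooth_partial: "smooth f \<Longrightarrow> smooth (partial f b)"
  unfolding smooth_def partial_def[abs_def] by (metis Ck.simps(2))

lemma smooth_has_derivative:
  "smooth f \<Longrightarrow> (f has_derivative (\<lambda>h. partial f h x)) (at x)"
  using smooth_differentiable[of f x] unfolding partial_def
  by (simp add: frechet_derivative_works[symmetric])

lemma has_derivative_imp_partial: "(f has_derivative D) (at x) \<Longrightarrow> partial f b x = D b"
  unfolding partial_def using frechet_derivative_at by metis

lemma partial_add_dir: "smooth f \<Longrightarrow> partial f (b + c) x = partial f b x + partial f c x"
  using has_derivative_linear[OF smooth_has_derivative[of f x]] linear_add by blast

lemma partial_scale_dir: "smooth f \<Longrightarrow> partial f (r *\<^sub>R b) x = r * partial f b x"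
  using linear_scale[OF has_derivative_linear[OF smooth_has_derivative[of f x]], of r b] by simp

lemma partial_eq_0: "(\<And>x. f x = 0) \<Longrightarrow> partial f b x = 0"
  using has_derivative_imp_partial[of f "\<lambda>_. 0" x b] has_derivative_const[of 0 "at x"]
  by (metis (no_types, lifting) ext)

lemma Ck_bounded_linear_comp:
  assumes "bounded_linear L" shows "Ck k f \<Longrightarrow> Ck k (\<lambda>x. L (f x))"
proof (induction k arbitrary: f)
  case 0
  then show ?case
    using bounded_linear.continuous_on[OF assms] by auto
next
  case (Suc k)
  have d: "((\<lambda>x. L (f x)) has_derivative (\<lambda>h. L (frechet_derivative f (at x) h))) (at x)" for x
    using Suc.prems by (intro bounded_linear.has_derivative[OF assms])
      (simp add: frechet_derivative_works[symmetric])
  have "frechet_derivative (\<lambda>x. L (f x)) (at x) v = L (frechet_derivative f (at x) v)" for x v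
    using frechet_derivative_at[OF d] by metis
  then show ?case
    using Suc differentiableI[OF d] by auto
qed

lemma smooth_bounded_linear_comp: "bounded_linear L \<Longrightarrow> smooth f \<Longrightarrow> smooth (\<lambda>x. L (f x))"
  unfolding smooth_def by (auto intro: Ck_bounded_linear_comp)

lemma smooth_const: "smooth (\<lambda>_. c)"
proof -
  have "Ck k (\<lambda>_::'a. d::'b)" for k d
    by (induction k arbitrary: d) auto
  then show ?thesis by (simp add: smooth_def)
qed

lemma smooth_affine:
  assumes "bounded_linear L" shows "smooth (\<lambda>x. c + L x)"
proof -
  have d: "((\<lambda>x. c + L x) has_derivative L) (at x)" for x
    using has_derivative_add[OF has_derivative_const bounded_linear_imp_has_derivative[OF assms]]
    by simp
  have fd: "frechet_derivative (\<lambda>x. c + L x) (at x) = L" for x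
    using frechet_derivative_at[OF d] by metis
  have "Ck k (\<lambda>x. c + L x)" for k
  proof (cases k)
    case 0
    then show ?thesis
      using d by (auto intro!: has_derivative_continuous_on[of UNIV _ "\<lambda>_. L"])
  next
    case (Suc m)
    then show ?thesis
      using d smooth_const by (auto simp: fd smooth_def differentiable_def)
  qed
  then show ?thesis by (simp add: smooth_def)
qed

section \<open>Equality of mixed partial derivatives\<close>

text \<open>The mean value theorem is applied once in each direction: to \<open>s \<mapsto> f (x + s b + h c) - f (x + s b)\<close>, and
  then to the difference of the two values of \<open>\<partial>\<^sub>b f\<close> that appears. The left-hand side is
  symmetric in \<open>b\<close> and \<open>c\<close>, which is what makes it useful for comparing mixed derivatives.\<close>

lemma second_difference_mean_value:
  fixes f :: "'a::real_normed_vector \<Rightarrow> real"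
  assumes f: "smooth f" and h: "h > 0"
  obtains r s where "0 < r" "r < h" "0 < s" "s < h"
    "f (x + h *\<^sub>R b + h *\<^sub>R c) - f (x + h *\<^sub>R b) - f (x + h *\<^sub>R c) + f x
      = h * h * partial (partial f b) c (x + r *\<^sub>R b + s *\<^sub>R c)"
proof -
  have along: "((\<lambda>s. g (y + s *\<^sub>R d)) has_real_derivative partial g d (y + s *\<^sub>R d)) (at s)"
    if "smooth g" for g :: "'a \<Rightarrow> real" and y d s
  proof -
    have 1: "((\<lambda>s. y + s *\<^sub>R d) has_derivative (\<lambda>k. k *\<^sub>R d)) (at s)"
      by (auto intro!: derivative_eq_intros)
    show ?thesis
      using has_derivative_compose[OF 1 smooth_has_derivative[OF that]]
      by (simp add: has_field_derivative_def partial_scale_dir[OF that] mult.commute[of "partial _ _ _"]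
          mult_commute_abs)
  qed
  define G where "G s = f ((x + h *\<^sub>R c) + s *\<^sub>R b) - f (x + s *\<^sub>R b)" for s
  have "(G has_real_derivative
      partial f b ((x + h *\<^sub>R c) + s *\<^sub>R b) - partial f b (x + s *\<^sub>R b)) (at s)" for s
    unfolding G_def by (intro DERIV_diff along f)
  then obtain r where r: "0 < r" "r < h"
    and Gr: "G h - G 0 = (h - 0) * (partial f b ((x + h *\<^sub>R c) + r *\<^sub>R b) - partial f b (x + r *\<^sub>R b))"
    using MVT2[OF h, of G "\<lambda>s. partial f b ((x + h *\<^sub>R c) + s *\<^sub>R b) - partial f b (x + s *\<^sub>R b)"]
    by blast
  obtain s where s: "0 < s" "s < h"
    and Hs: "partial f b ((x + r *\<^sub>R b) + h *\<^sub>R c) - partial f b ((x + r *\<^sub>R b) + 0 *\<^sub>R c)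
      = (h - 0) * partial (partial f b) c ((x + r *\<^sub>R b) + s *\<^sub>R c)"
    using MVT2[OF h along[OF smooth_partial[OF f]], of b "x + r *\<^sub>R b" c] by blast
  show thesis
    using that[OF r s] Gr Hs by (simp add: G_def algebra_simps)
qed

text \<open>Both mixed derivatives, each at some point near \<open>x\<close>, equal the same second difference quotient.
  If they differed at \<open>x\<close> by \<open>2 e\<close>, continuity would keep each within \<open>e\<close> of its value at
  \<open>x\<close> on a small parallelogram, and they could not agree there.\<close>

lemma partial_commute:
  fixes f :: "'a::real_normed_vector \<Rightarrow> real"
  assumes f: "smooth f"
  shows "partial (partial f b) c x = partial (partial f c) b x"
proof (rule ccontr)
  let ?F = "partial (partial f b) c" and ?G = "partial (partial f c) b"
  assume ne: "?F x \<noteq> ?G x"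
  define e where "e = \<bar>?F x - ?G x\<bar> / 2"
  have e: "e > 0" using ne by (simp add: e_def)
  have "isCont ?F x" "isCont ?G x"
    using smooth_continuous[OF smooth_partial[OF smooth_partial[OF f]]]
    by (auto simp: continuous_on_eq_continuous_at)
  then obtain d1 d2 where d: "d1 > 0" "d2 > 0"
    and F: "\<And>y. dist y x < d1 \<Longrightarrow> dist (?F y) (?F x) < e"
    and G: "\<And>y. dist y x < d2 \<Longrightarrow> dist (?G y) (?G x) < e"
    using e unfolding continuous_at_eps_delta by metis
  \<comment> \<open>Small enough for the parallelogram spanned by \<open>h b\<close> and \<open>h c\<close> to lie in both
    neighbourhoods; the summand 1 keeps the denominator positive when \<open>b = c = 0\<close>.\<close>
  define h where "h = min d1 d2 / (2 * (norm b + norm c + 1))"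
  have h: "h > 0" using d by (simp add: h_def add_nonneg_pos)
  have near: "dist (x + r *\<^sub>R b + s *\<^sub>R c) x < min d1 d2"
    if "0 < r" "r < h" "0 < s" "s < h" for r s
  proof -
    have "dist (x + r *\<^sub>R b + s *\<^sub>R c) x \<le> r * norm b + s * norm c"
      using norm_triangle_ineq[of "r *\<^sub>R b" "s *\<^sub>R c"] that by (simp add: dist_norm add.assoc)
    also have "\<dots> \<le> h * norm b + h * norm c"
      using that by (intro add_mono mult_right_mono) auto
    also have "\<dots> \<le> h * (norm b + norm c + 1)"
      using h by (simp add: algebra_simps)
    also have "\<dots> = min d1 d2 / 2"
      by (simp add: h_def add_nonneg_pos less_imp_neq[symmetric] field_simps add_nonneg_eq_0_iff)
    also have "\<dots> < min d1 d2" using d by (simp add: min_def)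
    finally show ?thesis .
  qed
  obtain r s where 1: "0 < r" "r < h" "0 < s" "s < h"
    "f (x + h *\<^sub>R b + h *\<^sub>R c) - f (x + h *\<^sub>R b) - f (x + h *\<^sub>R c) + f x
      = h * h * ?F (x + r *\<^sub>R b + s *\<^sub>R c)"
    using second_difference_mean_value[OF f h] by metis
  obtain r' s' where 2: "0 < r'" "r' < h" "0 < s'" "s' < h"
    "f (x + h *\<^sub>R c + h *\<^sub>R b) - f (x + h *\<^sub>R c) - f (x + h *\<^sub>R b) + f x
      = h * h * ?G (x + r' *\<^sub>R c + s' *\<^sub>R b)"
    using second_difference_mean_value[OF f h] by metis
  have eq: "?F (x + r *\<^sub>R b + s *\<^sub>R c) = ?G (x + r' *\<^sub>R c + s' *\<^sub>R b)"
  proof -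
    have "h * h * ?F (x + r *\<^sub>R b + s *\<^sub>R c) = h * h * ?G (x + r' *\<^sub>R c + s' *\<^sub>R b)"
      using 1(5) 2(5) by (simp only: add.assoc add.commute[of "h *\<^sub>R c"])
    then show ?thesis using h by simp
  qed
  have "dist (?F (x + r *\<^sub>R b + s *\<^sub>R c)) (?F x) < e"
    using near[OF 1(1-4)] by (intro F) auto
  moreover have "dist (?G (x + r' *\<^sub>R c + s' *\<^sub>R b)) (?G x) < e"
    using near[OF 2(3,4,1,2)] by (intro G) (auto simp: algebra_simps)
  ultimately show False
    using eq unfolding e_def dist_real_def by (auto simp: abs_if split: if_splits)
qed

text \<open>As an equation between functions this rewrites below further derivatives. Ordered
  rewriting with it sorts the directions of an iterated derivative of any order.\<close>

lemma partial_commute_fun: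
  fixes f :: "'a::real_normed_vector \<Rightarrow> real"
  assumes "smooth f"
  shows "partial (partial f b) c = partial (partial f c) b"
  using partial_commute[OF assms] by (simp add: fun_eq_iff)

section \<open>Partial derivatives in time and space\<close>

abbreviation (input) dt :: "(point \<Rightarrow> real) \<Rightarrow> point \<Rightarrow> real" where
  "dt f \<equiv> partial f (1, 0)"

abbreviation (input) dq :: "3 \<Rightarrow> (point \<Rightarrow> real) \<Rightarrow> point \<Rightarrow> real" where
  "dq j f \<equiv> partial f (0, axis j 1)"

lemma axis_component: "axis j (1::real) $ i = (if i = j then 1 else 0)"
  by (simp add: axis_def)

lemma vec3_eq_sum_axis: "v = v $ 1 *\<^sub>R axis 1 1 + v $ 2 *\<^sub>R axis 2 1 + v $ 3 *\<^sub>R (axis 3 1 :: real^3)"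
  by (simp add: vec_eq_iff forall_3 axis_def)

lemma partial_space:
  fixes f :: "point \<Rightarrow> real"
  assumes "smooth f"
  shows "partial f (0, v) x = v $ 1 * dq 1 f x + v $ 2 * dq 2 f x + v $ 3 * dq 3 f x"
proof -
  have "(0::real, v) = v $ 1 *\<^sub>R (0, axis 1 1) + v $ 2 *\<^sub>R (0, axis 2 1) + v $ 3 *\<^sub>R (0, axis 3 1)"
    using vec3_eq_sum_axis[of v] by simp
  then have "partial f (0, v) x = partial f (v $ 1 *\<^sub>R (0, axis 1 1) + v $ 2 *\<^sub>R (0, axis 2 1) + v $ 3 *\<^sub>R (0, axis 3 1)) x"
    by (rule arg_cong)
  then show ?thesis
    by (simp only: partial_add_dir[OF assms] partial_scale_dir[OF assms])
qed

lemma partial_vector: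
  fixes f :: "point \<Rightarrow> real"
  shows "smooth f \<Longrightarrow> partial f (0, vector [a, b, c]) x = a * dq 1 f x + b * dq 2 f x + c * dq 3 f x"
  by (simp add: partial_space[of f "vector [a, b, c]"])

lemma partial_space_scale:
  fixes f :: "point \<Rightarrow> real"
  assumes "smooth f" shows "partial f (0, s *\<^sub>R v) x = s * partial f (0, v) x"
  using partial_scale_dir[OF assms, of s "(0, v)"] by simp

lemma partial_time_space:
  fixes f :: "point \<Rightarrow> real"
  assumes "smooth f"
  shows "partial f (\<tau>, v) x = \<tau> * dt f x + partial f (0, v) x"
  using partial_add_dir[OF assms, of "\<tau> *\<^sub>R (1, 0)" "(0, v)"]
    partial_scale_dir[OF assms, of \<tau> "(1, 0)"] by simp

text \<open>The linear map \<open>h \<mapsto> partial f h 0\<close> has the same derivative as \<open>f\<close> everywhere, so \<open>f\<close>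
  differs from it by a constant.\<close>

lemma constant_gradient:
  fixes f :: "point \<Rightarrow> real"
  assumes f: "smooth f" and t: "\<And>x. dt f x = b" and q: "\<And>j x. dq j f x = g j"
  shows "f x = f 0 + b * fst x + g 1 * snd x $ 1 + g 2 * snd x $ 2 + g 3 * snd x $ 3"
proof -
  have p: "partial f h x = b * fst h + g 1 * snd h $ 1 + g 2 * snd h $ 2 + g 3 * snd h $ 3" for h x
    using partial_time_space[OF f, of "fst h" "snd h" x] by (simp add: t q partial_space[OF f, of "snd h"])
  have "((\<lambda>y. f y - partial f y 0) has_derivative (\<lambda>h. partial f h y - partial f h 0)) (at y)" for y
    by (intro has_derivative_diff smooth_has_derivative f bounded_linear_imp_has_derivative)
      (rule has_derivative_bounded_linear[OF smooth_has_derivative[OF f]])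
  then have "((\<lambda>y. f y - partial f y 0) has_derivative (\<lambda>h. 0)) (at y within UNIV)" for y
    by (simp add: p)
  then obtain k where "f y - partial f y 0 = k" for y
    using has_derivative_zero_constant[of UNIV "\<lambda>y. f y - partial f y 0"] by auto
  from this[of x] this[of 0] show ?thesis by (simp add: p)
qed

text \<open>The quadratic form of the Hessian of \<open>f\<close> in the variables \<open>q\<close>, evaluated at \<open>v\<close>.\<close>

definition hess :: "(point \<Rightarrow> real) \<Rightarrow> point \<Rightarrow> real^3 \<Rightarrow> real" where
  "hess f x v = (\<Sum>j\<in>UNIV. v $ j * partial (dq j f) (0, v) x)"

lemma hess_vector:
  assumes f: "smooth f"
  shows "hess f x (vector [a, b, c]) = a\<^sup>2 * dq 1 (dq 1 f) x + b\<^sup>2 * dq 2 (dq 2 f) x + c\<^sup>2 * dq 3 (dq 3 f) x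
    + 2 * a * b * dq 1 (dq 2 f) x + 2 * a * c * dq 1 (dq 3 f) x + 2 * b * c * dq 2 (dq 3 f) x"
proof -
  have 1: "dq 2 (dq 1 f) = dq 1 (dq 2 f)" "dq 3 (dq 1 f) = dq 1 (dq 3 f)" "dq 3 (dq 2 f) = dq 2 (dq 3 f)"
    by (rule partial_commute_fun[OF f])+
  show ?thesis
    by (simp add: hess_def sum_3 partial_space[OF smooth_partial[OF f], of _ "vector [a, b, c]"] 1
        algebra_simps power2_eq_square)
qed

lemma hess_scale: "smooth f \<Longrightarrow> hess f x (s *\<^sub>R v) = s\<^sup>2 * hess f x v"
  by (simp add: hess_def partial_space_scale smooth_partial sum_distrib_left power2_eq_square algebra_simps)

lemma has_derivative_coord:
  "((\<lambda>x::real \<times> (real^'n). snd x $ i) has_derivative (\<lambda>h. snd h $ i)) (at x)"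
  by (intro bounded_linear.has_derivative[OF bounded_linear_vec_nth] has_derivative_snd has_derivative_ident)

lemmas polynomial_derivative = has_derivative_coord has_derivative_add has_derivative_diff
  has_derivative_minus has_derivative_mult has_derivative_const smooth_has_derivative

text \<open>Turns a partial differential equation into the equation obtained by differentiating it along
  \<open>b\<close>. The derivatives \<open>F'\<close> and \<open>G'\<close> are separate variables so that the rules for derivatives can
  compute them from the syntactic form of the equation, and \<open>\<forall>\<close> fixes \<open>F\<close> and \<open>G\<close> uniquely:
  with a schematic point, unification could take them to be constant functions.\<close>

lemma differentiate_identity:
  fixes F :: "'a::real_normed_vector \<Rightarrow> real"
  assumes "\<forall>x. F x = G x" "(F has_derivative F') (at x)" "(G has_derivative G') (at x)"
    and "F' b = c" "G' b = d"
  shows "c = d"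
proof -
  have "F = G" using assms(1) by auto
  then have "F' = G'" using has_derivative_unique assms(2,3) by metis
  then show ?thesis using assms(4,5) by simp
qed

section \<open>The second prolongation\<close>

lemma total_deriv_smooth:
  "smooth f \<Longrightarrow> total_deriv f (t, q, v) = dt f (t, q) + partial f (0, v) (t, q)"
  by (simp add: total_deriv_def sum_3 partial_space[of f v])

text \<open>The total derivative is \<open>f\<^sub>t + \<Sum>\<^sub>j v\<^sub>j f\<^sub>j\<close>, a function on the first jet space that is linear in
  \<open>v\<close>. Its derivative is needed to form the second total derivative.\<close>

lemma total_deriv_has_derivative:
  assumes f: "smooth f"
  shows "(total_deriv f has_derivative (\<lambda>(\<tau>, \<kappa>, \<omega>).
    partial (dt f) (\<tau>, \<kappa>) (t, q) + (\<Sum>j\<in>UNIV. v $ j * partial (dq j f) (\<tau>, \<kappa>) (t, q)) + partial f (0, \<omega>) (t, q)))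
    (at (t, q, v))"
proof -
  have base: "((\<lambda>z::jet1. g (fst z, fst (snd z))) has_derivative
      (\<lambda>h. partial g (fst h, fst (snd h)) (t, q))) (at (t, q, v))" if "smooth g" for g :: "point \<Rightarrow> real"
  proof -
    have 1: "((\<lambda>z::jet1. (fst z, fst (snd z))) has_derivative (\<lambda>h. (fst h, fst (snd h)))) (at (t, q, v))"
      by (auto intro!: derivative_eq_intros)
    show ?thesis
      using has_derivative_compose[OF 1, of g] smooth_has_derivative[OF that, of "(t, q)"] by simp
  qed
  have vel: "((\<lambda>z::jet1. snd (snd z) $ j) has_derivative (\<lambda>h. snd (snd h) $ j)) (at (t, q, v))" for j
    by (intro bounded_linear.has_derivative[OF bounded_linear_vec_nth]) (auto intro!: derivative_eq_intros)
  have eq: "total_deriv f = (\<lambda>z. dt f (fst z, fst (snd z))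
      + (\<Sum>j\<in>UNIV. snd (snd z) $ j * dq j f (fst z, fst (snd z))))"
    by (auto simp: total_deriv_def fun_eq_iff)
  have prod: "((\<lambda>z. snd (snd z) $ j * dq j f (fst z, fst (snd z))) has_derivative
      (\<lambda>h. snd (snd (t, q, v)) $ j * partial (dq j f) (fst h, fst (snd h)) (t, q)
        + snd (snd h) $ j * dq j f (fst (t, q, v), fst (snd (t, q, v))))) (at (t, q, v))" for j
    by (rule has_derivative_mult[OF vel base[OF smooth_partial[OF f]]])
  have "(total_deriv f has_derivative (\<lambda>h. partial (dt f) (fst h, fst (snd h)) (t, q)
      + (\<Sum>j\<in>UNIV. snd (snd (t, q, v)) $ j * partial (dq j f) (fst h, fst (snd h)) (t, q)
        + snd (snd h) $ j * dq j f (fst (t, q, v), fst (snd (t, q, v)))))) (at (t, q, v))"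
    unfolding eq by (rule has_derivative_add[OF base[OF smooth_partial[OF f]] has_derivative_sum[OF prod]])
  then show ?thesis
    by (rule has_derivative_eq_rhs)
      (simp add: fun_eq_iff sum_3 case_prod_beta partial_space[OF f, of "snd (snd h)" for h] algebra_simps)
qed

text \<open>The factor 2 comes from the two mixed terms \<open>\<partial>\<^sub>t f\<^sub>j\<close> and \<open>\<partial>\<^sub>j f\<^sub>t\<close>, which agree.\<close>

lemma total_deriv2_smooth:
  assumes f: "smooth f"
  shows "total_deriv2 f (t, q, v, a) = dt (dt f) (t, q) + 2 * partial (dt f) (0, v) (t, q)
    + hess f (t, q) v + partial f (0, a) (t, q)"
proof -
  have P: "partial (total_deriv f) (\<tau>, \<kappa>, \<omega>) (t, q, v) = partial (dt f) (\<tau>, \<kappa>) (t, q)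
      + (\<Sum>j\<in>UNIV. v $ j * partial (dq j f) (\<tau>, \<kappa>) (t, q)) + partial f (0, \<omega>) (t, q)" for \<tau> \<kappa> \<omega>
    using has_derivative_imp_partial[OF total_deriv_has_derivative[OF f, of t q v], of "(\<tau>, \<kappa>, \<omega>)"]
    by simp
  note S = smooth_partial[OF f]
  have comm: "dt (dq j f) (t, q) = dq j (dt f) (t, q)" for j
    by (rule partial_commute[OF f])
  have z: "partial g (0, 0) (t, q) = 0" if "smooth g" for g
    using partial_scale_dir[OF that, of 0 "(0,0)"] by simp
  show ?thesis
    unfolding total_deriv2_def total_deriv1_def hess_def prod.case P z[OF S] z[OF f] comm
      partial_space[OF S, of _ v] partial_space[OF f, of a] sum_3
    by (simp add: algebra_simps)
qed

lemma vf_apply_has_derivative: "(f has_derivative D) (at x) \<Longrightarrow> vf_apply X f x = D (X x)"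
  unfolding vf_apply_def using frechet_derivative_at by metis

lemma vf_apply_eq1: "vf_apply X eq1 (t, q, v, a) =
    (case X (t, q, v, a) of (\<tau>, \<kappa>, \<omega>, \<alpha>) \<Rightarrow> \<alpha> $ 1 - \<kappa> $ 1 * v $ 3 - q $ 1 * \<omega> $ 3)"
  and vf_apply_eq2: "vf_apply X eq2 (t, q, v, a) =
    (case X (t, q, v, a) of (\<tau>, \<kappa>, \<omega>, \<alpha>) \<Rightarrow> \<alpha> $ 2 - \<kappa> $ 2 * v $ 3 - q $ 2 * \<omega> $ 3)"
  and vf_apply_eq3: "vf_apply X eq3 (t, q, v, a) =
    (case X (t, q, v, a) of (\<tau>, \<kappa>, \<omega>, \<alpha>) \<Rightarrow>
      \<alpha> $ 3 + \<kappa> $ 1 * v $ 1 + q $ 1 * \<omega> $ 1 + \<kappa> $ 2 * v $ 2 + q $ 2 * \<omega> $ 2)"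
proof -
  have q: "((\<lambda>z::jet2. fst (snd z) $ j) has_derivative (\<lambda>h. fst (snd h) $ j)) (at z)"
    and v: "((\<lambda>z::jet2. fst (snd (snd z)) $ j) has_derivative (\<lambda>h. fst (snd (snd h)) $ j)) (at z)"
    and a: "((\<lambda>z::jet2. snd (snd (snd z)) $ j) has_derivative (\<lambda>h. snd (snd (snd h)) $ j)) (at z)"
    for j z
    by (intro bounded_linear.has_derivative[OF bounded_linear_vec_nth];
        auto intro!: derivative_eq_intros)+
  have "eq1 = (\<lambda>z. snd (snd (snd z)) $ 1 - fst (snd z) $ 1 * fst (snd (snd z)) $ 3)"
    "eq2 = (\<lambda>z. snd (snd (snd z)) $ 2 - fst (snd z) $ 2 * fst (snd (snd z)) $ 3)"
    "eq3 = (\<lambda>z. snd (snd (snd z)) $ 3 + fst (snd z) $ 1 * fst (snd (snd z)) $ 1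
      + fst (snd z) $ 2 * fst (snd (snd z)) $ 2)"
    by (auto simp: eq1_def eq2_def eq3_def fun_eq_iff)
  note eqs = this
  note r = has_derivative_add has_derivative_diff has_derivative_mult q v a
  have "(eq1 has_derivative (\<lambda>(\<tau>, \<kappa>, \<omega>, \<alpha>). \<alpha> $ 1 - \<kappa> $ 1 * v $ 3 - q $ 1 * \<omega> $ 3)) (at (t, q, v, a))"
    unfolding eqs by (rule has_derivative_eq_rhs, (rule r)+) (auto simp: fun_eq_iff algebra_simps)
  then show "vf_apply X eq1 (t, q, v, a) =
    (case X (t, q, v, a) of (\<tau>, \<kappa>, \<omega>, \<alpha>) \<Rightarrow> \<alpha> $ 1 - \<kappa> $ 1 * v $ 3 - q $ 1 * \<omega> $ 3)"
    by (rule vf_apply_has_derivative[THEN trans]) simp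
  have "(eq2 has_derivative (\<lambda>(\<tau>, \<kappa>, \<omega>, \<alpha>). \<alpha> $ 2 - \<kappa> $ 2 * v $ 3 - q $ 2 * \<omega> $ 3)) (at (t, q, v, a))"
    unfolding eqs by (rule has_derivative_eq_rhs, (rule r)+) (auto simp: fun_eq_iff algebra_simps)
  then show "vf_apply X eq2 (t, q, v, a) =
    (case X (t, q, v, a) of (\<tau>, \<kappa>, \<omega>, \<alpha>) \<Rightarrow> \<alpha> $ 2 - \<kappa> $ 2 * v $ 3 - q $ 2 * \<omega> $ 3)"
    by (rule vf_apply_has_derivative[THEN trans]) simp
  have "(eq3 has_derivative (\<lambda>(\<tau>, \<kappa>, \<omega>, \<alpha>).
      \<alpha> $ 3 + \<kappa> $ 1 * v $ 1 + q $ 1 * \<omega> $ 1 + \<kappa> $ 2 * v $ 2 + q $ 2 * \<omega> $ 2)) (at (t, q, v, a))"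
    unfolding eqs by (rule has_derivative_eq_rhs, (rule r)+) (auto simp: fun_eq_iff algebra_simps)
  then show "vf_apply X eq3 (t, q, v, a) =
    (case X (t, q, v, a) of (\<tau>, \<kappa>, \<omega>, \<alpha>) \<Rightarrow>
      \<alpha> $ 3 + \<kappa> $ 1 * v $ 1 + q $ 1 * \<omega> $ 1 + \<kappa> $ 2 * v $ 2 + q $ 2 * \<omega> $ 2)"
    by (rule vf_apply_has_derivative[THEN trans]) simp
qed

lemma smooth_xi: "smooth u \<Longrightarrow> smooth (xi u)"
  using smooth_bounded_linear_comp[OF bounded_linear_fst, of u] by (simp add: xi_def[abs_def])

lemma smooth_eta: "smooth u \<Longrightarrow> smooth (eta u i)"
  using smooth_bounded_linear_comp[OF bounded_linear_compose[OF bounded_linear_vec_nth bounded_linear_snd], of u]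
  by (simp add: eta_def[abs_def])

text \<open>The velocity and acceleration coefficients of the second prolongation with the total
  derivatives expanded, so that every summand is homogeneous in \<open>v\<close> once \<open>a\<close> is linear in
  \<open>v\<close>.\<close>

definition prolong_vel :: "(point \<Rightarrow> point) \<Rightarrow> 3 \<Rightarrow> point \<Rightarrow> real^3 \<Rightarrow> real" where
  "prolong_vel u i x v = dt (eta u i) x + partial (eta u i) (0, v) x
    - (dt (xi u) x + partial (xi u) (0, v) x) * v $ i"

definition prolong_acc :: "(point \<Rightarrow> point) \<Rightarrow> 3 \<Rightarrow> point \<Rightarrow> real^3 \<Rightarrow> real^3 \<Rightarrow> real" where
  "prolong_acc u i x v a =
    dt (dt (eta u i)) x + 2 * partial (dt (eta u i)) (0, v) x + hess (eta u i) x v + partial (eta u i) (0, a) x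
    - (dt (dt (xi u)) x + 2 * partial (dt (xi u)) (0, v) x + hess (xi u) x v + partial (xi u) (0, a) x) * v $ i
    - 2 * (dt (xi u) x + partial (xi u) (0, v) x) * a $ i"

lemma prolong2_smooth:
  "smooth u \<Longrightarrow> prolong2 u (t, q, v, a) = (xi u (t, q), \<chi> i. eta u i (t, q),
    \<chi> i. prolong_vel u i (t, q) v, \<chi> i. prolong_acc u i (t, q) v a)"
  by (simp add: prolong2_def prolong_vel_def prolong_acc_def total_deriv_smooth total_deriv2_smooth
      smooth_xi smooth_eta)

lemma lie_point_symmetry_iff:
  "lie_point_symmetry u \<longleftrightarrow> smooth u \<and> (\<forall>x v.
     (let q = snd x; a = acceleration q v in
      prolong_acc u 1 x v a - eta u 1 x * v $ 3 - q $ 1 * prolong_vel u 3 x v = 0 \<and>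
      prolong_acc u 2 x v a - eta u 2 x * v $ 3 - q $ 2 * prolong_vel u 3 x v = 0 \<and>
      prolong_acc u 3 x v a + eta u 1 x * v $ 1 + q $ 1 * prolong_vel u 1 x v
        + eta u 2 x * v $ 2 + q $ 2 * prolong_vel u 2 x v = 0))"
proof (cases "smooth u")
  case True
  show ?thesis
    unfolding lie_point_symmetry_def split_paired_All ball_simps vf_apply_eq1 vf_apply_eq2 vf_apply_eq3
      prolong2_smooth[OF True] prod.case vec_lambda_beta Let_def snd_conv
    by blast
next
  case False
  then show ?thesis by (simp add: lie_point_symmetry_def)
qed

section \<open>The determining equations\<close>

lemma acceleration_scale: "acceleration q (s *\<^sub>R v) = s *\<^sub>R acceleration q v"
  by (simp add: acceleration_def vec_eq_iff forall_3 algebra_simps)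

lemma cubic_identically_zero:
  fixes c0 c1 c2 c3 :: real
  assumes "\<And>s. c0 + s * c1 + s\<^sup>2 * c2 + s ^ 3 * c3 = 0"
  shows "c0 = 0" "c1 = 0" "c2 = 0" "c3 = 0"
  using assms[of 0] assms[of 1] assms[of "-1"] assms[of 2] by simp_all

context
  fixes u assumes sym: "lie_point_symmetry u"
begin

abbreviation (input) "\<xi> \<equiv> xi u"

abbreviation (input) "\<eta> \<equiv> eta u"

lemma smooth_components: "smooth \<xi>" "smooth (\<eta> i)"
  using sym by (auto simp: lie_point_symmetry_def intro: smooth_xi smooth_eta)

lemmas smooths = smooth_components smooth_partial

text \<open>The homogeneous parts in \<open>v\<close> of the symmetry condition. The acceleration is linear in \<open>v\<close>, so
  at \<open>s v\<close> the condition is a cubic in \<open>s\<close> whose coefficients are the parts of degree 0 to 3.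
  The quadratic part has the same form for all \<open>i\<close> because the right-hand sides of the system are
  linear in \<open>v\<close>: the term \<open>- v\<^sub>k (\<xi>\<^sub>j v\<^sub>j)\<close> in each velocity coefficient reproduces the acceleration, and
  it cancels one of the two copies of \<open>a\<^sub>i \<xi>\<^sub>j v\<^sub>j\<close> in the acceleration coefficient.\<close>

lemma symmetry_graded:
  fixes A defines A: "\<And>x v. A x v \<equiv> acceleration (snd x) v"
  shows "hess \<xi> x v * v $ i = 0"
    and "hess (\<eta> i) x v = 2 * v $ i * partial (dt \<xi>) (0, v) x
          + v $ i * partial \<xi> (0, A x v) x + A x v $ i * partial \<xi> (0, v) x"
    and "2 * partial (dt (\<eta> 1)) (0, v) x + partial (\<eta> 1) (0, A x v) x
          - v $ 1 * dt (dt \<xi>) x - A x v $ 1 * dt \<xi> x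
         = \<eta> 1 x * v $ 3 + snd x $ 1 * partial (\<eta> 3) (0, v) x"
    and "2 * partial (dt (\<eta> 2)) (0, v) x + partial (\<eta> 2) (0, A x v) x
          - v $ 2 * dt (dt \<xi>) x - A x v $ 2 * dt \<xi> x
         = \<eta> 2 x * v $ 3 + snd x $ 2 * partial (\<eta> 3) (0, v) x"
    and "2 * partial (dt (\<eta> 3)) (0, v) x + partial (\<eta> 3) (0, A x v) x
          - v $ 3 * dt (dt \<xi>) x - A x v $ 3 * dt \<xi> x
         = - \<eta> 1 x * v $ 1 - snd x $ 1 * partial (\<eta> 1) (0, v) x
           - \<eta> 2 x * v $ 2 - snd x $ 2 * partial (\<eta> 2) (0, v) x"
    and "dt (dt (\<eta> 1)) x = snd x $ 1 * dt (\<eta> 3) x"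
proof -
  have A1: "A x v $ 1 = snd x $ 1 * v $ 3" and A2: "A x v $ 2 = snd x $ 2 * v $ 3"
    and A3: "A x v $ 3 = - snd x $ 1 * v $ 1 - snd x $ 2 * v $ 2"
    by (simp_all add: A acceleration_def)
  note scale = prolong_acc_def prolong_vel_def acceleration_scale partial_space_scale
    hess_scale smooths A[symmetric]
  have 1: "(dt (dt (\<eta> 1)) x - snd x $ 1 * dt (\<eta> 3) x)
      + s * (2 * partial (dt (\<eta> 1)) (0, v) x + partial (\<eta> 1) (0, A x v) x
          - v $ 1 * dt (dt \<xi>) x - A x v $ 1 * dt \<xi> x
         - \<eta> 1 x * v $ 3 - snd x $ 1 * partial (\<eta> 3) (0, v) x)
      + s\<^sup>2 * (hess (\<eta> 1) x v - 2 * v $ 1 * partial (dt \<xi>) (0, v) x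
          - v $ 1 * partial \<xi> (0, A x v) x - A x v $ 1 * partial \<xi> (0, v) x)
      + s ^ 3 * (- hess \<xi> x v * v $ 1) = 0" for s
    using sym[unfolded lie_point_symmetry_iff Let_def, THEN conjunct2, rule_format,
        of x "s *\<^sub>R v", THEN conjunct1]
    by (simp add: scale A1 A2 A3 algebra_simps power2_eq_square power3_eq_cube)
  have 2: "(dt (dt (\<eta> 2)) x - snd x $ 2 * dt (\<eta> 3) x)
      + s * (2 * partial (dt (\<eta> 2)) (0, v) x + partial (\<eta> 2) (0, A x v) x
          - v $ 2 * dt (dt \<xi>) x - A x v $ 2 * dt \<xi> x
         - \<eta> 2 x * v $ 3 - snd x $ 2 * partial (\<eta> 3) (0, v) x)
      + s\<^sup>2 * (hess (\<eta> 2) x v - 2 * v $ 2 * partial (dt \<xi>) (0, v) x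
          - v $ 2 * partial \<xi> (0, A x v) x - A x v $ 2 * partial \<xi> (0, v) x)
      + s ^ 3 * (- hess \<xi> x v * v $ 2) = 0" for s
    using sym[unfolded lie_point_symmetry_iff Let_def, THEN conjunct2, rule_format,
        of x "s *\<^sub>R v", THEN conjunct2, THEN conjunct1]
    by (simp add: scale A1 A2 A3 algebra_simps power2_eq_square power3_eq_cube)
  have 3: "(dt (dt (\<eta> 3)) x + snd x $ 1 * dt (\<eta> 1) x + snd x $ 2 * dt (\<eta> 2) x)
      + s * (2 * partial (dt (\<eta> 3)) (0, v) x + partial (\<eta> 3) (0, A x v) x
          - v $ 3 * dt (dt \<xi>) x - A x v $ 3 * dt \<xi> x
         + \<eta> 1 x * v $ 1 + snd x $ 1 * partial (\<eta> 1) (0, v) x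
           + \<eta> 2 x * v $ 2 + snd x $ 2 * partial (\<eta> 2) (0, v) x)
      + s\<^sup>2 * (hess (\<eta> 3) x v - 2 * v $ 3 * partial (dt \<xi>) (0, v) x
          - v $ 3 * partial \<xi> (0, A x v) x - A x v $ 3 * partial \<xi> (0, v) x)
      + s ^ 3 * (- hess \<xi> x v * v $ 3) = 0" for s
    using sym[unfolded lie_point_symmetry_iff Let_def, THEN conjunct2, rule_format,
        of x "s *\<^sub>R v", THEN conjunct2, THEN conjunct2]
    by (simp add: scale A1 A2 A3 algebra_simps power2_eq_square power3_eq_cube)
  note c = cubic_identically_zero[OF 1] cubic_identically_zero[OF 2] cubic_identically_zero[OF 3]
  have "i = 1 \<or> i = 2 \<or> i = 3" by (rule exhaust_3)
  then show "hess \<xi> x v * v $ i = 0"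
    using c(4,8,12) by auto
  show "hess (\<eta> i) x v = 2 * v $ i * partial (dt \<xi>) (0, v) x
          + v $ i * partial \<xi> (0, A x v) x + A x v $ i * partial \<xi> (0, v) x"
    using \<open>i = 1 \<or> i = 2 \<or> i = 3\<close> c(3,7,11) by (elim disjE) (simp_all add: algebra_simps)
  show "2 * partial (dt (\<eta> 1)) (0, v) x + partial (\<eta> 1) (0, A x v) x
          - v $ 1 * dt (dt \<xi>) x - A x v $ 1 * dt \<xi> x
         = \<eta> 1 x * v $ 3 + snd x $ 1 * partial (\<eta> 3) (0, v) x"
    using c(2) by linarith
  show "2 * partial (dt (\<eta> 2)) (0, v) x + partial (\<eta> 2) (0, A x v) x
          - v $ 2 * dt (dt \<xi>) x - A x v $ 2 * dt \<xi> x
         = \<eta> 2 x * v $ 3 + snd x $ 2 * partial (\<eta> 3) (0, v) x"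
    using c(6) by linarith
  show "2 * partial (dt (\<eta> 3)) (0, v) x + partial (\<eta> 3) (0, A x v) x
          - v $ 3 * dt (dt \<xi>) x - A x v $ 3 * dt \<xi> x
         = - \<eta> 1 x * v $ 1 - snd x $ 1 * partial (\<eta> 1) (0, v) x
           - \<eta> 2 x * v $ 2 - snd x $ 2 * partial (\<eta> 2) (0, v) x"
    using c(10) by linarith
  show "dt (dt (\<eta> 1)) x = snd x $ 1 * dt (\<eta> 3) x"
    using c(1) by simp
qed

lemma xi_space_hessian: "dq j (dq k \<xi>) x = 0"
proof -
  \<comment> \<open>The cubic part carries a factor \<open>v\<^sub>i\<close>, and for \<open>v \<noteq> 0\<close> some \<open>v\<^sub>i\<close> is nonzero.\<close>
  have "hess \<xi> x v = 0" for v
  proof (cases "v = 0")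
    case True
    then show ?thesis by (simp add: hess_def)
  next
    case False
    then obtain i where "v $ i \<noteq> 0" by (auto simp: vec_eq_iff)
    then show ?thesis using symmetry_graded(1)[of x v i] by simp
  qed
  then have h: "hess \<xi> x (vector [a, b, c]) = 0" for a b c .
  have c: "dq 2 (dq 1 \<xi>) = dq 1 (dq 2 \<xi>)" "dq 3 (dq 1 \<xi>) = dq 1 (dq 3 \<xi>)" "dq 3 (dq 2 \<xi>) = dq 2 (dq 3 \<xi>)"
    by (rule partial_commute_fun[OF smooth_components(1)])+
  have "dq 1 (dq 1 \<xi>) x = 0" "dq 2 (dq 2 \<xi>) x = 0" "dq 3 (dq 3 \<xi>) x = 0"
    "dq 1 (dq 2 \<xi>) x = 0" "dq 1 (dq 3 \<xi>) x = 0" "dq 2 (dq 3 \<xi>) x = 0"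
    using h[of 1 0 0] h[of 0 1 0] h[of 0 0 1] h[of 1 1 0] h[of 1 0 1] h[of 0 1 1]
    by (simp_all add: hess_vector smooths)
  moreover have "j = 1 \<or> j = 2 \<or> j = 3" "k = 1 \<or> k = 2 \<or> k = 3" by (rule exhaust_3)+
  ultimately show ?thesis using c by auto
qed

lemma xi_time_space_hessian:
  "dq j (dq k (dt \<xi>)) x = 0"
proof -
  have "dt (dq j (dq k \<xi>)) x = 0" by (rule partial_eq_0[OF xi_space_hessian])
  then show ?thesis
    by (simp only: partial_commute_fun smooths)
qed

lemma eta_space_hessian_vector:
  "hess (\<eta> i) x (vector [a, b, c]) =
    2 * vector [a, b, c] $ i * (a * dq 1 (dt \<xi>) x + b * dq 2 (dt \<xi>) x + c * dq 3 (dt \<xi>) x)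
    + vector [a, b, c] $ i * (snd x $ 1 * c * dq 1 \<xi> x + snd x $ 2 * c * dq 2 \<xi> x
        + (- snd x $ 1 * a - snd x $ 2 * b) * dq 3 \<xi> x)
    + acceleration (snd x) (vector [a, b, c]) $ i * (a * dq 1 \<xi> x + b * dq 2 \<xi> x + c * dq 3 \<xi> x)"
  using symmetry_graded(2)[of i x "vector [a, b, c]"]
  by (simp add: acceleration_def partial_vector smooths)

text \<open>The integrability condition for the Hessians of \<open>\<eta>\<^sub>1\<close> and \<open>\<eta>\<^sub>2\<close>. Each \<open>\<partial>\<^sub>l\<xi>\<close> enters some second derivative
  with a coefficient \<open>q\<^sub>m\<close>; differentiating by \<open>q\<^sub>m\<close> isolates it, since all second derivatives
  of \<open>\<xi>\<close> in \<open>q\<close> vanish, while the same third derivative computed in another order is zero. For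
  \<open>\<partial>\<^sub>3\<xi>\<close> the third derivative is \<open>\<partial>\<^sub>1\<partial>\<^sub>2\<partial>\<^sub>2\<eta>\<^sub>1\<close>, for \<open>\<partial>\<^sub>1\<xi>\<close> it is \<open>\<partial>\<^sub>1\<partial>\<^sub>1\<partial>\<^sub>3\<eta>\<^sub>1\<close>, and for \<open>\<partial>\<^sub>2\<xi>\<close> it is
  \<open>\<partial>\<^sub>2\<partial>\<^sub>2\<partial>\<^sub>3\<eta>\<^sub>2\<close>.\<close>

lemma xi_space_gradient: "dq j \<xi> x = 0"
proof -
  note Q = eta_space_hessian_vector[unfolded hess_vector[OF smooth_components(2)] acceleration_def]
  note comm = partial_commute_fun[OF smooth_partial] partial_commute_fun smooths
  \<comment> \<open>The instances \<open>Q[of a i x b c]\<close> are the quadratic part of equation \<open>i\<close> at \<open>v = (a, b, c)\<close>;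
    the sums of two unit vectors give the mixed second derivatives.\<close>
  have f11: "\<forall>x. dq 1 (dq 1 (\<eta> 1)) x = 2 * dq 1 (dt \<xi>) x - snd x $ 1 * dq 3 \<xi> x"
    using Q[of 1 1 _ 0 0] by simp
  have f22: "dq 2 (dq 2 (\<eta> 1)) x = 0" for x
    using Q[of 0 1 x 1 0] by simp
  have f33: "dq 3 (dq 3 (\<eta> 1)) x = snd x $ 1 * dq 3 \<xi> x" for x
    using Q[of 0 1 x 0 1] by simp
  have g22: "\<forall>x. dq 2 (dq 2 (\<eta> 2)) x = 2 * dq 2 (dt \<xi>) x - snd x $ 2 * dq 3 \<xi> x"
    using Q[of 0 2 _ 1 0] by simp
  have g33: "dq 3 (dq 3 (\<eta> 2)) x = snd x $ 2 * dq 3 \<xi> x" for x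
    using Q[of 0 2 x 0 1] by simp
  have f12: "\<forall>x. 2 * dq 1 (dq 2 (\<eta> 1)) x = 2 * dq 2 (dt \<xi>) x - snd x $ 2 * dq 3 \<xi> x"
    using Q[of 1 1 _ 1 0] f11 f22 by (simp add: algebra_simps)
  have f13: "\<forall>x. 2 * dq 1 (dq 3 (\<eta> 1)) x
      = 2 * dq 3 (dt \<xi>) x + 2 * snd x $ 1 * dq 1 \<xi> x + snd x $ 2 * dq 2 \<xi> x"
    using Q[of 1 1 _ 0 1] f11 f33 by (simp add: algebra_simps)
  have g23: "\<forall>x. 2 * dq 2 (dq 3 (\<eta> 2)) x
      = 2 * dq 3 (dt \<xi>) x + 2 * snd x $ 2 * dq 2 \<xi> x + snd x $ 1 * dq 1 \<xi> x"
    using Q[of 0 2 _ 1 1] g22 g33 by (simp add: algebra_simps)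
  have "2 * dq 2 (dq 1 (dq 2 (\<eta> 1))) x = - dq 3 \<xi> x"
    by (rule differentiate_identity[OF f12, where b = "(0, axis 2 1)"], (rule polynomial_derivative smooths)+)
      (simp_all add: xi_space_hessian xi_time_space_hessian axis_component)
  moreover have "dq 1 (dq 2 (dq 2 (\<eta> 1))) x = 0"
    by (rule partial_eq_0[OF f22])
  ultimately have 3: "dq 3 \<xi> x = 0"
    by (simp add: comm)
  have "dq 3 (dq 1 (dq 1 (\<eta> 1))) x = 0"
    by (rule differentiate_identity[OF f11, where b = "(0, axis 3 1)"], (rule polynomial_derivative smooths)+)
      (simp_all add: xi_space_hessian xi_time_space_hessian axis_component)
  moreover have "2 * dq 1 (dq 1 (dq 3 (\<eta> 1))) x = 2 * dq 1 \<xi> x"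
    by (rule differentiate_identity[OF f13, where b = "(0, axis 1 1)"], (rule polynomial_derivative smooths)+)
      (simp_all add: xi_space_hessian xi_time_space_hessian axis_component)
  ultimately have 1: "dq 1 \<xi> x = 0"
    by (simp add: comm)
  have "dq 3 (dq 2 (dq 2 (\<eta> 2))) x = 0"
    by (rule differentiate_identity[OF g22, where b = "(0, axis 3 1)"], (rule polynomial_derivative smooths)+)
      (simp_all add: xi_space_hessian xi_time_space_hessian axis_component)
  moreover have "2 * dq 2 (dq 2 (dq 3 (\<eta> 2))) x = 2 * dq 2 \<xi> x"
    by (rule differentiate_identity[OF g23, where b = "(0, axis 2 1)"], (rule polynomial_derivative smooths)+)
      (simp_all add: xi_space_hessian xi_time_space_hessian axis_component)
  ultimately have 2: "dq 2 \<xi> x = 0"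
    by (simp add: comm)
  show ?thesis using exhaust_3[of j] 1 2 3 by auto
qed

lemma xi_mixed_hessian: "dq j (dt \<xi>) x = 0"
proof -
  have "dt (dq j \<xi>) x = 0"
    by (rule partial_eq_0[OF xi_space_gradient])
  then show ?thesis
    by (simp only: partial_commute_fun smooths)
qed

lemma eta_space_hessian: "dq j (dq k (\<eta> i)) x = 0"
proof -
  have h: "hess (\<eta> i) x (vector [a, b, c]) = 0" for a b c
    unfolding eta_space_hessian_vector by (simp add: xi_space_gradient xi_mixed_hessian)
  have c: "dq 2 (dq 1 (\<eta> i)) = dq 1 (dq 2 (\<eta> i))" "dq 3 (dq 1 (\<eta> i)) = dq 1 (dq 3 (\<eta> i))"
    "dq 3 (dq 2 (\<eta> i)) = dq 2 (dq 3 (\<eta> i))"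
    by (rule partial_commute_fun[OF smooth_components(2)])+
  have "dq 1 (dq 1 (\<eta> i)) x = 0" "dq 2 (dq 2 (\<eta> i)) x = 0" "dq 3 (dq 3 (\<eta> i)) x = 0"
    "dq 1 (dq 2 (\<eta> i)) x = 0" "dq 1 (dq 3 (\<eta> i)) x = 0" "dq 2 (dq 3 (\<eta> i)) x = 0"
    using h[of 1 0 0] h[of 0 1 0] h[of 0 0 1] h[of 1 1 0] h[of 1 0 1] h[of 0 1 1]
    by (simp_all add: hess_vector smooths)
  moreover have "j = 1 \<or> j = 2 \<or> j = 3" "k = 1 \<or> k = 2 \<or> k = 3" by (rule exhaust_3)+
  ultimately show ?thesis using c by auto
qed

lemma eta_time_space_hessian: "dq j (dq k (dt (\<eta> i))) x = 0"
proof -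
  have "dt (dq j (dq k (\<eta> i))) x = 0" by (rule partial_eq_0[OF eta_space_hessian])
  then show ?thesis
    by (simp only: partial_commute_fun smooths)
qed

lemmas vanishing = xi_space_gradient xi_mixed_hessian xi_space_hessian xi_time_space_hessian
  eta_space_hessian eta_time_space_hessian

text \<open>Coefficients of the part of degree one: \<open>Lij\<close> comes from equation \<open>i\<close> at \<open>v = e\<^sub>j\<close>.\<close>

lemma symmetry_linear_coords:
  shows L11: "\<forall>x. 2 * dq 1 (dt (\<eta> 1)) x - snd x $ 1 * dq 3 (\<eta> 1) x - dt (dt \<xi>) x
      = snd x $ 1 * dq 1 (\<eta> 3) x" (is "\<forall>x. ?P11 x")
    and L12: "\<forall>x. 2 * dq 2 (dt (\<eta> 1)) x - snd x $ 2 * dq 3 (\<eta> 1) x = snd x $ 1 * dq 2 (\<eta> 3) x" (is "\<forall>x. ?P12 x")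
    and L13: "\<forall>x. 2 * dq 3 (dt (\<eta> 1)) x + snd x $ 1 * dq 1 (\<eta> 1) x + snd x $ 2 * dq 2 (\<eta> 1) x
      - snd x $ 1 * dt \<xi> x = \<eta> 1 x + snd x $ 1 * dq 3 (\<eta> 3) x" (is "\<forall>x. ?P13 x")
    and L21: "\<forall>x. 2 * dq 1 (dt (\<eta> 2)) x - snd x $ 1 * dq 3 (\<eta> 2) x = snd x $ 2 * dq 1 (\<eta> 3) x" (is "\<forall>x. ?P21 x")
    and L23: "\<forall>x. 2 * dq 3 (dt (\<eta> 2)) x + snd x $ 1 * dq 1 (\<eta> 2) x + snd x $ 2 * dq 2 (\<eta> 2) x
      - snd x $ 2 * dt \<xi> x = \<eta> 2 x + snd x $ 2 * dq 3 (\<eta> 3) x" (is "\<forall>x. ?P23 x")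
    and L31: "\<forall>x. 2 * dq 1 (dt (\<eta> 3)) x - snd x $ 1 * dq 3 (\<eta> 3) x + snd x $ 1 * dt \<xi> x
      = - \<eta> 1 x - snd x $ 1 * dq 1 (\<eta> 1) x - snd x $ 2 * dq 1 (\<eta> 2) x" (is "\<forall>x. ?P31 x")
    and L32: "\<forall>x. 2 * dq 2 (dt (\<eta> 3)) x - snd x $ 2 * dq 3 (\<eta> 3) x + snd x $ 2 * dt \<xi> x
      = - \<eta> 2 x - snd x $ 1 * dq 2 (\<eta> 1) x - snd x $ 2 * dq 2 (\<eta> 2) x" (is "\<forall>x. ?P32 x")
    and L33: "\<forall>x. 2 * dq 3 (dt (\<eta> 3)) x + snd x $ 1 * dq 1 (\<eta> 3) x + snd x $ 2 * dq 2 (\<eta> 3) x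
      - dt (dt \<xi>) x = - snd x $ 1 * dq 3 (\<eta> 1) x - snd x $ 2 * dq 3 (\<eta> 2) x" (is "\<forall>x. ?P33 x")
proof -
  have "?P11 x" for x
    using symmetry_graded(3)[where v = "vector [1, 0, 0]" and x = x]
    by (simp add: acceleration_def partial_vector smooths)
  then show "\<forall>x. ?P11 x" by blast
  have "?P12 x" for x
    using symmetry_graded(3)[where v = "vector [0, 1, 0]" and x = x]
    by (simp add: acceleration_def partial_vector smooths)
  then show "\<forall>x. ?P12 x" by blast
  have "?P13 x" for x
    using symmetry_graded(3)[where v = "vector [0, 0, 1]" and x = x]
    by (simp add: acceleration_def partial_vector smooths)
  then show "\<forall>x. ?P13 x" by blast
  have "?P21 x" for x
    using symmetry_graded(4)[where v = "vector [1, 0, 0]" and x = x]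
    by (simp add: acceleration_def partial_vector smooths)
  then show "\<forall>x. ?P21 x" by blast
  have "?P23 x" for x
    using symmetry_graded(4)[where v = "vector [0, 0, 1]" and x = x]
    by (simp add: acceleration_def partial_vector smooths)
  then show "\<forall>x. ?P23 x" by blast
  have "?P31 x" for x
    using symmetry_graded(5)[where v = "vector [1, 0, 0]" and x = x]
    by (simp add: acceleration_def partial_vector smooths)
  then show "\<forall>x. ?P31 x" by blast
  have "?P32 x" for x
    using symmetry_graded(5)[where v = "vector [0, 1, 0]" and x = x]
    by (simp add: acceleration_def partial_vector smooths)
  then show "\<forall>x. ?P32 x" by blast
  have "?P33 x" for x
    using symmetry_graded(5)[where v = "vector [0, 0, 1]" and x = x]
    by (simp add: acceleration_def partial_vector smooths)
  then show "\<forall>x. ?P33 x" by blast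
qed

text \<open>All derivatives of \<open>\<xi>\<close> and \<open>\<eta>\<close> in these equations are independent of \<open>q\<close>, since \<open>\<xi>\<close> depends on \<open>t\<close>
  alone and \<open>\<eta>\<close> is affine in \<open>q\<close>. Differentiating an equation by \<open>q\<^sub>k\<close> therefore reads off the coefficient of \<open>q\<^sub>k\<close>.\<close>

lemma eta_first_order:
  shows "dq 3 (\<eta> 1) x = 0" "dq 3 (\<eta> 2) x = 0" "dq 1 (\<eta> 3) x = 0" "dq 2 (\<eta> 3) x = 0"
    and "dq 1 (\<eta> 1) x = - dt \<xi> x" "dq 2 (\<eta> 2) x = - dt \<xi> x" "dq 3 (\<eta> 3) x = - dt \<xi> x"
    and "dq 1 (\<eta> 2) x = - dq 2 (\<eta> 1) x"
proof -
  note D = polynomial_derivative smooths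
  have "- dq 3 (\<eta> 1) x = 0"
    by (rule differentiate_identity[OF L12, where b = "(0, axis 2 1)" and x = x], (rule D)+)
      (simp_all add: vanishing axis_component)
  then show a: "dq 3 (\<eta> 1) x = 0" by simp
  have "0 = dq 2 (\<eta> 3) x"
    by (rule differentiate_identity[OF L12, where b = "(0, axis 1 1)" and x = x], (rule D)+)
      (simp_all add: vanishing axis_component)
  then show "dq 2 (\<eta> 3) x = 0" by simp
  have "- dq 3 (\<eta> 2) x = 0"
    by (rule differentiate_identity[OF L21, where b = "(0, axis 1 1)" and x = x], (rule D)+)
      (simp_all add: vanishing axis_component)
  then show "dq 3 (\<eta> 2) x = 0" by simp
  have "0 = dq 1 (\<eta> 3) x"
    by (rule differentiate_identity[OF L21, where b = "(0, axis 2 1)" and x = x], (rule D)+)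
      (simp_all add: vanishing axis_component)
  then show "dq 1 (\<eta> 3) x = 0" by simp
  have "dq 1 (\<eta> 1) x - dt \<xi> x = dq 1 (\<eta> 1) x + dq 3 (\<eta> 3) x"
    by (rule differentiate_identity[OF L13, where b = "(0, axis 1 1)" and x = x], (rule D)+)
      (simp_all add: vanishing axis_component)
  then show b: "dq 3 (\<eta> 3) x = - dt \<xi> x" by simp
  have "- dq 3 (\<eta> 3) x + dt \<xi> x = - dq 1 (\<eta> 1) x - dq 1 (\<eta> 1) x"
    by (rule differentiate_identity[OF L31, where b = "(0, axis 1 1)" and x = x], (rule D)+)
      (simp_all add: vanishing axis_component)
  with b show "dq 1 (\<eta> 1) x = - dt \<xi> x" by simp
  have "- dq 3 (\<eta> 3) x + dt \<xi> x = - dq 2 (\<eta> 2) x - dq 2 (\<eta> 2) x"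
    by (rule differentiate_identity[OF L32, where b = "(0, axis 2 1)" and x = x], (rule D)+)
      (simp_all add: vanishing axis_component)
  with b show "dq 2 (\<eta> 2) x = - dt \<xi> x" by simp
  have "0 = - dq 2 (\<eta> 1) x - dq 1 (\<eta> 2) x"
    by (rule differentiate_identity[OF L31, where b = "(0, axis 2 1)" and x = x], (rule D)+)
      (simp_all add: vanishing axis_component)
  then show "dq 1 (\<eta> 2) x = - dq 2 (\<eta> 1) x" by simp
qed

text \<open>Two different multiples of \<open>\<xi>\<^sub>t\<^sub>t\<close> are equal: \<open>\<partial>\<^sub>3\<eta>\<^sub>3 = -\<xi>\<^sub>t\<close> gives \<open>2 \<partial>\<^sub>t\<partial>\<^sub>3\<eta>\<^sub>3 = -2 \<xi>\<^sub>t\<^sub>t\<close>, while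
  \<open>L33\<close> gives \<open>2 \<partial>\<^sub>t\<partial>\<^sub>3\<eta>\<^sub>3 = \<xi>\<^sub>t\<^sub>t\<close>.\<close>

lemma xi_second_time: "dt (dt \<xi>) x = 0"
proof -
  have "dt (dq 3 (\<eta> 3)) x = - dt (dt \<xi>) x"
    by (rule differentiate_identity[where F = "dq 3 (\<eta> 3)" and G = "\<lambda>x. - dt \<xi> x" and x = x], 
        simp add: eta_first_order, (rule polynomial_derivative smooths)+) simp_all
  moreover have "2 * dq 3 (dt (\<eta> 3)) x = dt (dt \<xi>) x"
    using L33[rule_format, of x] by (simp add: eta_first_order)
  ultimately show ?thesis
    by (simp add: partial_commute_fun smooths)
qed

lemma eta12_gradient: "dt (dq 2 (\<eta> 1)) x = 0" "dq j (dq 2 (\<eta> 1)) x = 0"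
  using L12[rule_format, of x] eta_space_hessian
  by (simp_all add: eta_first_order partial_commute_fun smooths)

text \<open>\<open>L13\<close> and \<open>L23\<close> contain \<open>\<eta>\<^sub>1\<close> and \<open>\<eta>\<^sub>2\<close> undifferentiated, so they can be solved for them; this
  excludes any term of \<open>\<eta>\<^sub>1\<close>, \<open>\<eta>\<^sub>2\<close> that depends on \<open>t\<close> only.\<close>

lemma eta_12_formula:
  "\<eta> 1 x = - dt \<xi> x * snd x $ 1 + dq 2 (\<eta> 1) x * snd x $ 2"
  "\<eta> 2 x = - dq 2 (\<eta> 1) x * snd x $ 1 - dt \<xi> x * snd x $ 2"
proof -
  have "dt (dq 3 (\<eta> 1)) x = 0" "dt (dq 3 (\<eta> 2)) x = 0"
    by (rule partial_eq_0[OF eta_first_order(1)] partial_eq_0[OF eta_first_order(2)])+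
  then have "dq 3 (dt (\<eta> 1)) x = 0" "dq 3 (dt (\<eta> 2)) x = 0"
    by (simp_all only: partial_commute_fun smooths)
  then show "\<eta> 1 x = - dt \<xi> x * snd x $ 1 + dq 2 (\<eta> 1) x * snd x $ 2"
    "\<eta> 2 x = - dq 2 (\<eta> 1) x * snd x $ 1 - dt \<xi> x * snd x $ 2"
    using L13[rule_format, of x] L23[rule_format, of x]
    by (simp_all add: eta_first_order algebra_simps)
qed

text \<open>The part of degree zero in the first equation is \<open>\<partial>\<^sub>t\<partial>\<^sub>t\<eta>\<^sub>1 = q\<^sub>1 \<partial>\<^sub>t\<eta>\<^sub>3\<close>. Differentiated by \<open>q\<^sub>1\<close>, its
  left-hand side vanishes because \<open>\<partial>\<^sub>t\<partial>\<^sub>1\<eta>\<^sub>1\<close> does, and its right-hand side is \<open>\<partial>\<^sub>t\<eta>\<^sub>3\<close>.\<close>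

lemma eta3_time: "dt (\<eta> 3) x = 0"
proof -
  have c: "\<forall>x. dt (dt (\<eta> 1)) x = snd x $ 1 * dt (\<eta> 3) x"
    using symmetry_graded(6) by simp
  have "dt (dq 1 (\<eta> 3)) x = 0" for x by (rule partial_eq_0[OF eta_first_order(3)])
  then have z: "dq 1 (dt (\<eta> 3)) x = 0" for x by (simp add: partial_commute_fun smooths)
  have "dq 1 (dt (\<eta> 1)) x = 0" for x
    using L11[rule_format, of x] by (simp add: eta_first_order xi_second_time)
  then have "dt (dq 1 (dt (\<eta> 1))) x = 0"
    by (rule partial_eq_0)
  moreover have "dq 1 (dt (dt (\<eta> 1))) x = dt (\<eta> 3) x"
    by (rule differentiate_identity[OF c, where b = "(0, axis 1 1)" and x = x],
        (rule polynomial_derivative smooths)+) (simp_all add: z axis_component)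
  ultimately show ?thesis by (simp add: partial_commute_fun smooths)
qed

end

section \<open>The four-parameter family of symmetries\<close>

text \<open>The combination of time translation (\<open>a\<close>), scaling (\<open>b\<close>), rotation of the \<open>(q\<^sub>1, q\<^sub>2)\<close> plane
  (\<open>c\<close>) and translation along \<open>q\<^sub>3\<close> (\<open>d\<close>).\<close>

definition symmetry_field :: "real \<Rightarrow> real \<Rightarrow> real \<Rightarrow> real \<Rightarrow> point \<Rightarrow> point" where
  "symmetry_field a b c d = (\<lambda>(t, q).
     (a + b * t, vector [c * q $ 2 - b * q $ 1, - c * q $ 1 - b * q $ 2, d - b * q $ 3]))"

lemma symmetry_imp_field:
  assumes sym: "lie_point_symmetry u"
  shows "\<exists>a b c d. u = symmetry_field a b c d"
proof -
  let ?\<xi> = "xi u" and ?\<eta> = "eta u"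
  note smooths = smooth_components[OF sym] smooth_partial
  note vanishing = vanishing[OF sym] and xi_second_time = xi_second_time[OF sym]
    and eta12_gradient = eta12_gradient[OF sym] and eta_first_order = eta_first_order[OF sym]
    and eta3_time = eta3_time[OF sym] and eta_12_formula = eta_12_formula[OF sym]
  define b where "b = dt ?\<xi> 0"
  define c where "c = dq 2 (?\<eta> 1) 0"
  have b: "dt ?\<xi> x = b" for x
    unfolding b_def using constant_gradient[of "dt ?\<xi>" 0 "\<lambda>_. 0" x]
    by (simp add: smooths vanishing xi_second_time)
  have c: "dq 2 (?\<eta> 1) x = c" for x
    unfolding c_def using constant_gradient[of "dq 2 (?\<eta> 1)" 0 "\<lambda>_. 0" x]
    by (simp add: smooths eta12_gradient)
  have 0: "?\<xi> x = ?\<xi> 0 + b * fst x" for x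
    using constant_gradient[of ?\<xi> b "\<lambda>_. 0" x] by (simp add: smooths vanishing b)
  have g3: "dq j (?\<eta> 3) x = (if j = 3 then - b else 0)" for j x
    using exhaust_3[of j] by (auto simp: eta_first_order b)
  have 3: "?\<eta> 3 x = ?\<eta> 3 0 - b * snd x $ 3" for x
    using constant_gradient[of "?\<eta> 3" 0 "\<lambda>j. if j = 3 then - b else 0" x]
    by (simp add: smooths eta3_time g3)
  have "u x = symmetry_field (?\<xi> 0) b c (?\<eta> 3 0) x" for x
  proof (rule prod_eqI)
    show "fst (u x) = fst (symmetry_field (?\<xi> 0) b c (?\<eta> 3 0) x)"
      using 0[of x] by (simp add: xi_def symmetry_field_def case_prod_beta)
    have "snd (u x) $ 1 = - b * snd x $ 1 + c * snd x $ 2"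
      "snd (u x) $ 2 = - c * snd x $ 1 - b * snd x $ 2"
      "snd (u x) $ 3 = ?\<eta> 3 0 - b * snd x $ 3"
      using eta_12_formula[of x] 3[of x] by (simp_all add: b c eta_def[of u _ x])
    then show "snd (u x) = snd (symmetry_field (?\<xi> 0) b c (?\<eta> 3 0) x)"
      by (simp add: symmetry_field_def case_prod_beta vec_eq_iff forall_3)
  qed
  then show ?thesis by blast
qed

text \<open>The fields are affine, and the linear part of one is again a field of the family.\<close>

lemma symmetry_field_has_derivative:
  "(symmetry_field a b c d has_derivative symmetry_field 0 b c 0) (at x)"
  and smooth_symmetry_field: "smooth (symmetry_field a b c d)"
proof -
  have "linear (symmetry_field 0 b c 0)"
    by (intro linearI) (auto simp: symmetry_field_def vec_eq_iff forall_3 algebra_simps)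
  then have L: "bounded_linear (symmetry_field 0 b c 0)"
    by (simp add: linear_conv_bounded_linear)
  have eq: "symmetry_field a b c d = (\<lambda>x. (a, vector [0, 0, d]) + symmetry_field 0 b c 0 x)"
    by (auto simp: symmetry_field_def vec_eq_iff forall_3)
  show "(symmetry_field a b c d has_derivative symmetry_field 0 b c 0) (at x)"
    unfolding eq
    using has_derivative_add[OF has_derivative_const bounded_linear_imp_has_derivative[OF L]] by simp
  show "smooth (symmetry_field a b c d)"
    unfolding eq by (rule smooth_affine[OF L])
qed

text \<open>First derivatives of the coefficients are constant and second derivatives vanish, so the
  condition is an algebraic identity in \<open>q\<close> and \<open>v\<close>.\<close>

lemma lie_point_symmetry_field: "lie_point_symmetry (symmetry_field a b c d)"
proof -
  let ?u = "symmetry_field a b c d" and ?L = "symmetry_field 0 b c 0"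
  have xi: "partial (xi ?u) h = (\<lambda>x. fst (?L h))" for h
    unfolding xi_def[abs_def]
    by (rule ext, rule has_derivative_imp_partial[OF has_derivative_fst[OF symmetry_field_has_derivative]])
  have eta: "partial (eta ?u i) h = (\<lambda>x. snd (?L h) $ i)" for i h
    unfolding eta_def[abs_def]
    by (rule ext, rule has_derivative_imp_partial[OF
        bounded_linear.has_derivative[OF bounded_linear_vec_nth
          has_derivative_snd[OF symmetry_field_has_derivative]]])
  have const: "partial (\<lambda>_::point. k) h = (\<lambda>_. 0)" for k :: real and h
    by (rule ext, rule has_derivative_imp_partial[OF has_derivative_const])
  show ?thesis
    unfolding lie_point_symmetry_iff prolong_acc_def prolong_vel_def hess_def xi eta const
    by (intro conjI smooth_symmetry_field)
      (auto simp: eta_def symmetry_field_def acceleration_def Let_def algebra_simps)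
qed

lemma lie_point_symmetries_eq:
  "{u. lie_point_symmetry u} = {symmetry_field a b c d | a b c d. True}"
  using symmetry_imp_field lie_point_symmetry_field by blast

section \<open>The Lie algebra and its dimension\<close>

lemma symmetry_field_add:
  "symmetry_field a b c d + symmetry_field a' b' c' d' = symmetry_field (a + a') (b + b') (c + c') (d + d')"
  by (auto simp: symmetry_field_def fun_eq_iff vec_eq_iff forall_3 algebra_simps)

lemma symmetry_field_scale:
  "vf_scale r (symmetry_field a b c d) = symmetry_field (r * a) (r * b) (r * c) (r * d)"
  by (auto simp: symmetry_field_def vf_scale_def fun_eq_iff vec_eq_iff forall_3 algebra_simps)

lemma symmetry_field_eq_0_iff:
  "symmetry_field a b c d = 0 \<longleftrightarrow> a = 0 \<and> b = 0 \<and> c = 0 \<and> d = 0"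
proof
  assume z: "symmetry_field a b c d = 0"
  have "symmetry_field a b c d x = 0" for x using z by simp
  from this[of "(0, 0)"] this[of "(1, 0)"] this[of "(0, axis 1 1)"]
  show "a = 0 \<and> b = 0 \<and> c = 0 \<and> d = 0"
    by (simp add: symmetry_field_def vec_eq_iff forall_3 zero_prod_def axis_def)
qed (auto simp: symmetry_field_def fun_eq_iff vec_eq_iff forall_3 zero_prod_def)

text \<open>The only nonzero brackets of the generators are those of the scaling with the two translations.\<close>

lemma symmetry_field_bracket:
  "vf_bracket (symmetry_field a b c d) (symmetry_field a' b' c' d')
    = symmetry_field (a * b' - a' * b) 0 0 (b * d' - b' * d)"
  unfolding vf_bracket_def vf_apply_has_derivative[OF symmetry_field_has_derivative]
  by (auto simp: symmetry_field_def fun_eq_iff vec_eq_iff forall_3 algebra_simps)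

lemma lie_point_symmetries_subspace: "vf.subspace {u. lie_point_symmetry u}"
proof (rule vf.subspaceI)
  show "0 \<in> {u. lie_point_symmetry u}"
    using lie_point_symmetry_field[of 0 0 0 0] symmetry_field_eq_0_iff[of 0 0 0 0] by simp
next
  fix x y assume "x \<in> {u. lie_point_symmetry u}" "y \<in> {u. lie_point_symmetry u}"
  then show "x + y \<in> {u. lie_point_symmetry u}"
    unfolding lie_point_symmetries_eq using symmetry_field_add by blast
next
  fix r x assume "x \<in> {u. lie_point_symmetry u}"
  then show "vf_scale r x \<in> {u. lie_point_symmetry u}"
    unfolding lie_point_symmetries_eq using symmetry_field_scale by blast
qed

lemma lie_point_symmetries_lie_algebra: "real_lie_algebra vf_scale vf_bracket {u. lie_point_symmetry u}"
proof -
  note ops = symmetry_field_add symmetry_field_scale symmetry_field_bracket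
  show ?thesis
  proof (intro real_lie_algebra.intro real_lie_algebra_axioms.intro vf.vector_space_axioms
      lie_point_symmetries_subspace)
  qed (auto dest!: symmetry_imp_field simp: ops lie_point_symmetry_field symmetry_field_eq_0_iff algebra_simps)
qed

lemma dim_lie_point_symmetries: "vf.dim {u. lie_point_symmetry u} = 4"
proof -
  let ?X = "[symmetry_field 1 0 0 0, symmetry_field 0 1 0 0, symmetry_field 0 0 1 0, symmetry_field 0 0 0 1]"
  have inj: "symmetry_field a b c d = symmetry_field a' b' c' d' \<longleftrightarrow> a = a' \<and> b = b' \<and> c = c' \<and> d = d'"
    for a b c d a' b' c' d'
  proof -
    have "symmetry_field a b c d = symmetry_field a' b' c' d'
      \<longleftrightarrow> symmetry_field a b c d + vf_scale (-1) (symmetry_field a' b' c' d') = 0"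
      by (simp add: vf.scale_minus_left)
    then show ?thesis by (simp add: symmetry_field_add symmetry_field_scale symmetry_field_eq_0_iff)
  qed
  \<comment> \<open>Evaluating the sum over the set needs the four fields to be distinct.\<close>
  have combo: "(\<Sum>x\<in>set ?X. vf_scale (f x) x) = symmetry_field (f (?X ! 0)) (f (?X ! 1)) (f (?X ! 2)) (f (?X ! 3))" for f
    by (simp add: inj symmetry_field_scale symmetry_field_add numeral_3_eq_3)
  have "vf.independent (set ?X)"
  proof (rule vf.independent_if_scalars_zero)
    fix f x assume z: "(\<Sum>x\<in>set ?X. vf_scale (f x) x) = 0" and x: "x \<in> set ?X"
    from z x show "f x = 0"
      unfolding combo symmetry_field_eq_0_iff by (auto simp: numeral_3_eq_3)
  qed simp
  moreover have "vf.span (set ?X) = vf.span {u. lie_point_symmetry u}"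
  proof
    show "vf.span (set ?X) \<subseteq> vf.span {u. lie_point_symmetry u}"
      by (rule vf.span_mono) (auto simp: lie_point_symmetry_field)
    have "symmetry_field a b c d \<in> vf.span (set ?X)" for a b c d
    proof -
      have "symmetry_field a b c d = vf_scale a (?X ! 0) + (vf_scale b (?X ! 1) + (vf_scale c (?X ! 2) + vf_scale d (?X ! 3)))"
        by (simp add: symmetry_field_scale symmetry_field_add numeral_3_eq_3)
      also have "\<dots> \<in> vf.span (set ?X)"
        by (intro vf.span_add vf.span_scale vf.span_base) auto
      finally show ?thesis .
    qed
    then show "vf.span {u. lie_point_symmetry u} \<subseteq> vf.span (set ?X)"
      by (intro vf.span_minimal) (auto simp: lie_point_symmetries_eq)
  qed
  moreover have "card (set ?X) = 4"
    by (simp add: inj)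
  ultimately show ?thesis
    using vf.dim_eq_card by metis
qed

theorem proposition3p2:
  shows "real_lie_algebra vf_scale vf_bracket {u. lie_point_symmetry u}
    \<and> vf.dim {u. lie_point_symmetry u} = 4"
  using lie_point_symmetries_lie_algebra dim_lie_point_symmetries by blast

end
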